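(* Let $G$ be a zero-sum two-by-two game with payoff pairs $(X_1,Y_1),\ldots,(X_4,Y_4)$ (so $X_t+Y_t=0$ for each $t$; $X_t$ is Player One's payoff and $Y_t$ is Player Two's). Then in any mixed-strategy Nash equilibrium of the associated quantum game $G^Q$, Player One earns exactly $(X_1+X_2+X_3+X_4)/4$.
   Context: Let $G$ be a two-by-two game: two players, each with strategy set $\{C,D\}$, and payoff functions $P_1,P_2:\{C,D\}^2\to\mathbb{R}$. For a quaternion $p$ write $p=\pi_1(p)+\pi_2(p)i+\pi_3(p)j+\pi_4(p)k$ with $\pi_t(p)\in\mathbb{R}$. The associated quantum game $G^Q$ is the two-player game in which each player's strategy set is the set of unit quaternions and, if Player One plays $p$ and Player Two plays $q$, Player $i$ receives $$P_i^Q(p,q)=\pi_1(pq)^2P_i(C,C)+\pi_2(pq)^2P_i(D,D)+\pi_3(pq)^2P_i(C,D)+\pi_4(pq)^2P_i(D,C).$$ A mixed strategy is a probability measure on the unit quaternions; for mixed strategies $\nu,\mu$ of Players One and Two, $P_i^Q(\nu,\mu)=\int P_i^Q(p,q)\,d\nu(p)\,d\mu(q)$. A mixed-strategy Nash equilibrium of $G^Q$ is a Nash equilibrium of the game in which strategies are mixed strategies with these payoffs; what Player $i$ earns in it is $P_i^Q(\nu,\mu)$. *)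

theory Defs
  imports "HOL-Probability.Probability"
begin

text \<open>A quaternion \<open>a + b i + c j + d k\<close> is the vector \<open>(a, b, c, d)\<close>, so that its \<open>t\<close>-th real
  coordinate is \<open>p $ t\<close>, and the Euclidean norm and the Borel sets are those of the usual topology.
  The multiplication that the type class \<^class>\<open>times\<close> provides on \<^typ>\<open>real ^ 4\<close> is componentwise;
  the quaternion product is \<open>qmult\<close>.\<close>

type_synonym quat = "real ^ 4"

definition qmult :: "quat \<Rightarrow> quat \<Rightarrow> quat" (infixl \<open>\<otimes>\<^sub>Q\<close> 70) where
  "p \<otimes>\<^sub>Q q = vector
     [p $ 1 * q $ 1 - p $ 2 * q $ 2 - p $ 3 * q $ 3 - p $ 4 * q $ 4,
      p $ 1 * q $ 2 + p $ 2 * q $ 1 + p $ 3 * q $ 4 - p $ 4 * q $ 3,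
      p $ 1 * q $ 3 - p $ 2 * q $ 4 + p $ 3 * q $ 1 + p $ 4 * q $ 2,
      p $ 1 * q $ 4 + p $ 2 * q $ 3 - p $ 3 * q $ 2 + p $ 4 * q $ 1]"

definition unit_quats :: "quat set" where
  "unit_quats = {p. norm p = 1}"

datatype move = C | D

datatype player = Player1 | Player2

text \<open>\<open>G i a b\<close> is what player \<open>i\<close> receives when Player One plays \<open>a\<close> and Player Two plays \<open>b\<close>.\<close>

type_synonym game = "player \<Rightarrow> move \<Rightarrow> move \<Rightarrow> real"

definition zero_sum :: "game \<Rightarrow> bool" where
  "zero_sum G \<longleftrightarrow> (\<forall>a b. G Player1 a b + G Player2 a b = 0)"

definition quantum_payoff :: "game \<Rightarrow> player \<Rightarrow> quat \<Rightarrow> quat \<Rightarrow> real" where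
  "quantum_payoff G i p q =
     ((p \<otimes>\<^sub>Q q) $ 1)\<^sup>2 * G i C C + ((p \<otimes>\<^sub>Q q) $ 2)\<^sup>2 * G i D D +
     ((p \<otimes>\<^sub>Q q) $ 3)\<^sup>2 * G i C D + ((p \<otimes>\<^sub>Q q) $ 4)\<^sup>2 * G i D C"

definition mixed_strategies :: "quat measure set" where
  "mixed_strategies =
     {\<nu>. prob_space \<nu> \<and> sets \<nu> = sets (restrict_space borel unit_quats)}"

definition mixed_payoff :: "game \<Rightarrow> player \<Rightarrow> quat measure \<Rightarrow> quat measure \<Rightarrow> real" where
  "mixed_payoff G i \<nu> \<mu> = (\<integral>(p, q). quantum_payoff G i p q \<partial>(\<nu> \<Otimes>\<^sub>M \<mu>))"

definition nash_equilibrium ::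
    "'s set \<Rightarrow> 't set \<Rightarrow> (player \<Rightarrow> 's \<Rightarrow> 't \<Rightarrow> real) \<Rightarrow> 's \<Rightarrow> 't \<Rightarrow> bool" where
  "nash_equilibrium S T u s t \<longleftrightarrow>
     s \<in> S \<and> t \<in> T \<and>
     (\<forall>s'\<in>S. u Player1 s' t \<le> u Player1 s t) \<and>
     (\<forall>t'\<in>T. u Player2 s t' \<le> u Player2 s t)"

definition mixed_quantum_nash :: "game \<Rightarrow> quat measure \<Rightarrow> quat measure \<Rightarrow> bool" where
  "mixed_quantum_nash G = nash_equilibrium mixed_strategies mixed_strategies (mixed_payoff G)"

end

theory Submission imports Defs begin

text \<open>Let \<open>u\<close> be the mixed strategy that plays \<open>1, i, j, k\<close> with probability \<open>1/4\<close> each. Multiplying a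
  unit quaternion by \<open>1, i, j, k\<close>, on either side, permutes its coordinates up to sign, and over the
  four multiplications each coordinate visits each position exactly once. Hence whoever plays \<open>u\<close>
  receives the average of the four classical payoffs against every pure reply, and so against every
  mixed one. In a zero-sum game this gives both players a guarantee, and the two guarantees meet.\<close>

lemma qmult_components:
  "(p \<otimes>\<^sub>Q q) $ 1 = p $ 1 * q $ 1 - p $ 2 * q $ 2 - p $ 3 * q $ 3 - p $ 4 * q $ 4"
  "(p \<otimes>\<^sub>Q q) $ 2 = p $ 1 * q $ 2 + p $ 2 * q $ 1 + p $ 3 * q $ 4 - p $ 4 * q $ 3"
  "(p \<otimes>\<^sub>Q q) $ 3 = p $ 1 * q $ 3 - p $ 2 * q $ 4 + p $ 3 * q $ 1 + p $ 4 * q $ 2"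
  "(p \<otimes>\<^sub>Q q) $ 4 = p $ 1 * q $ 4 + p $ 2 * q $ 3 - p $ 3 * q $ 2 + p $ 4 * q $ 1"
  by (simp_all add: qmult_def vector_def)

lemma norm_quat_squared: "(norm (p :: quat))\<^sup>2 = (p $ 1)\<^sup>2 + (p $ 2)\<^sup>2 + (p $ 3)\<^sup>2 + (p $ 4)\<^sup>2"
  by (simp add: norm_vec_def L2_set_def sum_4)

text \<open>Euler's four-square identity. It keeps products of unit quaternions on the unit sphere,
  which is what bounds the payoff.\<close>

lemma norm_qmult: "norm (p \<otimes>\<^sub>Q q) = norm p * norm q"
proof -
  have "(norm (p \<otimes>\<^sub>Q q))\<^sup>2 = (norm p * norm q)\<^sup>2"
    unfolding power_mult_distrib norm_quat_squared qmult_components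
    by (simp add: power2_eq_square algebra_simps)
  then show ?thesis by simp
qed

definition game_average :: "game \<Rightarrow> player \<Rightarrow> real" where
  "game_average G i = (G i C C + G i D D + G i C D + G i D C) / 4"

text \<open>The vectors \<open>axis t 1\<close> are 1, i, j, k. The target of the pushforward is the
  restricted Borel space because \<open>mixed_strategies\<close> prescribes exactly that
  sigma-algebra.\<close>

definition uniform_basis :: "quat measure" where
  "uniform_basis = distr (measure_pmf (pmf_of_set (UNIV :: 4 set)))
     (restrict_space borel unit_quats) (\<lambda>t. axis t 1)"

lemma measurable_axis_unit_quats:
  "(\<lambda>t. axis t 1) \<in> measure_pmf P \<rightarrow>\<^sub>M restrict_space borel unit_quats"
  by (rule measurable_restrict_space2) (simp_all add: unit_quats_def)

lemma uniform_basis_mixed: "uniform_basis \<in> mixed_strategies"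
  unfolding mixed_strategies_def uniform_basis_def
  using prob_space.prob_space_distr[OF prob_space_measure_pmf measurable_axis_unit_quats] by simp

lemma space_mixed:
  assumes "\<nu> \<in> mixed_strategies"
  shows "space \<nu> = unit_quats"
  using assms sets_eq_imp_space_eq[of \<nu> "restrict_space borel unit_quats"]
  by (simp add: mixed_strategies_def space_restrict_space)

lemma integral_uniform_basis:
  fixes f :: "quat \<Rightarrow> real"
  assumes "f \<in> borel_measurable uniform_basis"
  shows "(\<integral>p. f p \<partial>uniform_basis) = (\<Sum>t\<in>UNIV. f (axis t 1)) / 4"
proof -
  have "f \<in> borel_measurable (restrict_space borel unit_quats)"
    using assms by (simp add: uniform_basis_def)
  then show ?thesis
    unfolding uniform_basis_def
    by (subst integral_distr[OF measurable_axis_unit_quats]) (simp_all add: integral_pmf_of_set)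
qed

lemma sum_basis_quantum_payoff_left:
  assumes "norm q = 1"
  shows "(\<Sum>t\<in>UNIV. quantum_payoff G i (axis t 1) q) / 4 = game_average G i"
proof -
  have "(q $ 1)\<^sup>2 + (q $ 2)\<^sup>2 + (q $ 3)\<^sup>2 + (q $ 4)\<^sup>2 = 1"
    using assms norm_quat_squared[of q] by simp
  \<comment> \<open>An identity of quadratic forms in \<open>q\<close>: squaring removes the signs,
    and each of the four payoffs collects every squared coordinate of \<open>q\<close> once.\<close>
  moreover have "(\<Sum>t\<in>UNIV. quantum_payoff G i (axis t 1) q) =
      ((q $ 1)\<^sup>2 + (q $ 2)\<^sup>2 + (q $ 3)\<^sup>2 + (q $ 4)\<^sup>2) * (4 * game_average G i)"
    unfolding sum_4 quantum_payoff_def qmult_components game_average_def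
    by (simp add: axis_def algebra_simps)
  ultimately show ?thesis by simp
qed

lemma sum_basis_quantum_payoff_right:
  assumes "norm p = 1"
  shows "(\<Sum>t\<in>UNIV. quantum_payoff G i p (axis t 1)) / 4 = game_average G i"
proof -
  have "(p $ 1)\<^sup>2 + (p $ 2)\<^sup>2 + (p $ 3)\<^sup>2 + (p $ 4)\<^sup>2 = 1"
    using assms norm_quat_squared[of p] by simp
  moreover have "(\<Sum>t\<in>UNIV. quantum_payoff G i p (axis t 1)) =
      ((p $ 1)\<^sup>2 + (p $ 2)\<^sup>2 + (p $ 3)\<^sup>2 + (p $ 4)\<^sup>2) * (4 * game_average G i)"
    unfolding sum_4 quantum_payoff_def qmult_components game_average_def
    by (simp add: axis_def algebra_simps)
  ultimately show ?thesis by simp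
qed

text \<open>The product is again a unit quaternion, so each squared coordinate is at most 1. A
  bounded measurable payoff is integrable against probability measures, as Fubini's theorem
  requires.\<close>

lemma quantum_payoff_bounded:
  assumes "norm p = 1" "norm q = 1"
  shows "\<bar>quantum_payoff G i p q\<bar> \<le> \<bar>G i C C\<bar> + \<bar>G i D D\<bar> + \<bar>G i C D\<bar> + \<bar>G i D C\<bar>"
proof -
  have "((p \<otimes>\<^sub>Q q) $ t)\<^sup>2 \<le> 1" for t
    using component_le_norm_cart[of "p \<otimes>\<^sub>Q q" t] assms by (simp add: norm_qmult abs_square_le_1)
  then have term_bound: "\<bar>((p \<otimes>\<^sub>Q q) $ t)\<^sup>2 * x\<bar> \<le> \<bar>x\<bar>" for t x
    by (simp add: abs_mult mult_left_le_one_le)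
  show ?thesis
    unfolding quantum_payoff_def
    by (intro order.trans[OF abs_triangle_ineq] add_mono term_bound)
qed

lemma borel_measurable_quantum_payoff:
  "(\<lambda>(p, q). quantum_payoff G i p q) \<in> borel_measurable borel"
  unfolding quantum_payoff_def qmult_components case_prod_beta
  by (intro borel_measurable_continuous_onI continuous_intros)

text \<open>The inclusion of the unit quaternions into the whole space is measurable in each factor,
  and by \<open>borel_prod\<close> the product of the two Borel algebras is the Borel algebra of the
  pairs, where the payoff is continuous.\<close>

lemma borel_measurable_quantum_payoff_mixed:
  assumes "\<nu> \<in> mixed_strategies" "\<mu> \<in> mixed_strategies"
  shows "(\<lambda>(p, q). quantum_payoff G i p q) \<in> borel_measurable (\<nu> \<Otimes>\<^sub>M \<mu>)"
proof -
  have id_borel: "(\<lambda>x. x) \<in> \<kappa> \<rightarrow>\<^sub>M borel" if "\<kappa> \<in> mixed_strategies" for \<kappa>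
    using that measurable_restrict_space1[of "\<lambda>x. x" borel borel unit_quats]
    by (simp add: mixed_strategies_def cong: measurable_cong_sets)
  note measurable_Pair[OF measurable_compose[OF measurable_fst id_borel[OF assms(1)]]
      measurable_compose[OF measurable_snd id_borel[OF assms(2)]]]
  then have "(\<lambda>x. x) \<in> \<nu> \<Otimes>\<^sub>M \<mu> \<rightarrow>\<^sub>M borel"
    by (simp add: borel_prod)
  from measurable_compose[OF this borel_measurable_quantum_payoff] show ?thesis .
qed

lemma integrable_quantum_payoff:
  assumes "\<nu> \<in> mixed_strategies" "\<mu> \<in> mixed_strategies"
  shows "integrable (\<nu> \<Otimes>\<^sub>M \<mu>) (\<lambda>(p, q). quantum_payoff G i p q)"
proof -
  interpret \<nu>: prob_space \<nu> using assms by (simp add: mixed_strategies_def)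
  interpret \<mu>: prob_space \<mu> using assms by (simp add: mixed_strategies_def)
  interpret pair_prob_space \<nu> \<mu> ..
  show ?thesis
    using quantum_payoff_bounded[of _ _ G i] assms
    by (intro P.integrable_const_bound[OF AE_I2 borel_measurable_quantum_payoff_mixed])
       (auto simp: space_pair_measure space_mixed unit_quats_def)
qed

lemma mixed_payoff_uniform_basis_left:
  assumes \<mu>: "\<mu> \<in> mixed_strategies"
  shows "mixed_payoff G i uniform_basis \<mu> = game_average G i"
proof -
  let ?u = uniform_basis
  interpret u: prob_space ?u using uniform_basis_mixed by (simp add: mixed_strategies_def)
  interpret \<mu>: prob_space \<mu> using \<mu> by (simp add: mixed_strategies_def)
  interpret pair_prob_space ?u \<mu> ..
  have inner: "(\<integral>p. quantum_payoff G i p q \<partial>?u) = game_average G i" if "q \<in> space \<mu>" for q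
  proof -
    \<comment> \<open>A section of a jointly measurable function is measurable.\<close>
    have "(\<lambda>p. quantum_payoff G i p q) \<in> borel_measurable ?u"
      using measurable_compose[OF measurable_Pair2'[OF that]
          borel_measurable_quantum_payoff_mixed[OF uniform_basis_mixed \<mu>]] by simp
    then show ?thesis
      using that \<mu>
      by (simp add: integral_uniform_basis sum_basis_quantum_payoff_left space_mixed unit_quats_def)
  qed
  \<comment> \<open>Fubini, with the uniform player's variable innermost: the inner integral is then
    constant in \<open>q\<close>.\<close>
  have "mixed_payoff G i ?u \<mu> = (\<integral>q. (\<integral>p. quantum_payoff G i p q \<partial>?u) \<partial>\<mu>)"
    unfolding mixed_payoff_def
    using integral_snd[OF integrable_quantum_payoff[OF uniform_basis_mixed \<mu>]] by simp
  also have "\<dots> = (\<integral>q. game_average G i \<partial>\<mu>)"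
    by (intro Bochner_Integration.integral_cong refl inner)
  finally show ?thesis by (simp add: \<mu>.prob_space)
qed

lemma mixed_payoff_uniform_basis_right:
  assumes \<nu>: "\<nu> \<in> mixed_strategies"
  shows "mixed_payoff G i \<nu> uniform_basis = game_average G i"
proof -
  let ?u = uniform_basis
  interpret u: prob_space ?u using uniform_basis_mixed by (simp add: mixed_strategies_def)
  interpret \<nu>: prob_space \<nu> using \<nu> by (simp add: mixed_strategies_def)
  interpret pair_prob_space \<nu> ?u ..
  have inner: "(\<integral>q. quantum_payoff G i p q \<partial>?u) = game_average G i" if "p \<in> space \<nu>" for p
  proof -
    have "(\<lambda>q. quantum_payoff G i p q) \<in> borel_measurable ?u"
      using measurable_compose[OF measurable_Pair1'[OF that]
          borel_measurable_quantum_payoff_mixed[OF \<nu> uniform_basis_mixed]] by simp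
    then show ?thesis
      using that \<nu>
      by (simp add: integral_uniform_basis sum_basis_quantum_payoff_right space_mixed unit_quats_def)
  qed
  \<comment> \<open>Here the uniform player is the second one, so Fubini is applied in the other
    order.\<close>
  have "mixed_payoff G i \<nu> ?u = (\<integral>p. (\<integral>q. quantum_payoff G i p q \<partial>?u) \<partial>\<nu>)"
    unfolding mixed_payoff_def
    using integral_fst[OF integrable_quantum_payoff[OF \<nu> uniform_basis_mixed]] by simp
  also have "\<dots> = (\<integral>p. game_average G i \<partial>\<nu>)"
    by (intro Bochner_Integration.integral_cong refl inner)
  finally show ?thesis by (simp add: \<nu>.prob_space)
qed

lemma zero_sum_Player2:
  assumes "zero_sum G"
  shows "G Player2 a b = - G Player1 a b"
  using assms by (simp add: zero_sum_def eq_neg_iff_add_eq_0 add.commute)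

text \<open>This turns Player Two's equilibrium inequality into an upper bound on what Player One
  earns.\<close>

lemma mixed_payoff_zero_sum:
  assumes "zero_sum G"
  shows "mixed_payoff G Player2 \<nu> \<mu> = - mixed_payoff G Player1 \<nu> \<mu>"
proof -
  have "quantum_payoff G Player2 p q = - quantum_payoff G Player1 p q" for p q
    by (simp add: quantum_payoff_def zero_sum_Player2[OF assms])
  then show ?thesis
    unfolding mixed_payoff_def case_prod_beta by simp
qed

theorem corollary4:
  fixes G :: game
    and X\<^sub>1 X\<^sub>2 X\<^sub>3 X\<^sub>4 Y\<^sub>1 Y\<^sub>2 Y\<^sub>3 Y\<^sub>4 :: real
    and \<nu> \<mu> :: "quat measure"
  assumes "(G Player1 C C, G Player2 C C) = (X\<^sub>1, Y\<^sub>1)"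
    and "(G Player1 D D, G Player2 D D) = (X\<^sub>2, Y\<^sub>2)"
    and "(G Player1 C D, G Player2 C D) = (X\<^sub>3, Y\<^sub>3)"
    and "(G Player1 D C, G Player2 D C) = (X\<^sub>4, Y\<^sub>4)"
    and "zero_sum G"
    and "mixed_quantum_nash G \<nu> \<mu>"
  shows "mixed_payoff G Player1 \<nu> \<mu> = (X\<^sub>1 + X\<^sub>2 + X\<^sub>3 + X\<^sub>4) / 4"
proof -
  \<comment> \<open>Of all deviations, only the one to \<open>uniform_basis\<close> is tested, once
    for each player.\<close>
  have \<nu>: "\<nu> \<in> mixed_strategies" and \<mu>: "\<mu> \<in> mixed_strategies"
    and best1: "mixed_payoff G Player1 uniform_basis \<mu> \<le> mixed_payoff G Player1 \<nu> \<mu>"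
    and best2: "mixed_payoff G Player2 \<nu> uniform_basis \<le> mixed_payoff G Player2 \<nu> \<mu>"
    using assms(6) uniform_basis_mixed
    by (auto simp: mixed_quantum_nash_def nash_equilibrium_def)
  have "mixed_payoff G Player1 \<nu> \<mu> = game_average G Player1"
  proof (rule antisym)
    show "mixed_payoff G Player1 \<nu> \<mu> \<le> game_average G Player1"
      using best2 mixed_payoff_uniform_basis_right[OF \<nu>, of G Player1]
      by (simp add: mixed_payoff_zero_sum[OF assms(5)])
    show "game_average G Player1 \<le> mixed_payoff G Player1 \<nu> \<mu>"
      using best1 by (simp add: mixed_payoff_uniform_basis_left[OF \<mu>])
  qed
  then show ?thesis
    using assms(1-4) by (simp add: game_average_def)
qed

end
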